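(* Let a rate $R$ with $0<R<1$ and an error-correcting capability $t\ge 1$ (an integer) be required. An $(n,r)$ MDS code with $r\ge nR$ that corrects $t$ errors must satisfy $n-r+1\ge 2t+1$, and this requires $n(1-R)\ge 2t$, i.e. $n\ge\frac{2t}{1-R}$. Conversely, MDS codes to these requirements are constructed as follows. Let $n\ge\frac{2t}{1-R}$, let $\mathbb{F}$ be a finite field over which a Fourier $n\times n$ matrix $F_n$ exists (such a field of characteristic $p$ exists for every prime $p$ not dividing $n$), and take $r\ge nR$ rows of $F_n$, subject to the requirement $n-r+1\ge 2t+1$, in arithmetic sequence with arithmetic difference $k$ satisfying $\gcd(n,k)=1$. The code generated by these rows has the required parameters: it is an MDS $(n,r,n-r+1)$ code over $\mathbb{F}$ whose rate $\frac{r}{n}$ is at least $R$ (equal to $R$ when $r=nR$) and whose error-correcting capability is at least $t$.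
   Context: An $(n,r)$ linear code over a field $\mathbb{F}$ is an $r$-dimensional linear subspace of $\mathbb{F}^n$; its rate is $\frac{r}{n}$. An $(n,r,d)$ code is one with (minimum) distance $d$, the minimum Hamming weight of a nonzero codeword; its error-correcting capability is $\lfloor\frac{d-1}{2}\rfloor$. The code is MDS (maximum distance separable) if $d=n-r+1$. A primitive $n$-th root of unity in $\mathbb{F}$ is an element $\omega$ with $\omega^n=1$ and $\omega^i\ne 1$ for $1\le i<n$. The Fourier $n\times n$ matrix $F_n$ over $\mathbb{F}$ determined by such an $\omega$ has $(i,j)$ entry $\omega^{ij}$ for $0\le i,j\le n-1$; denote its rows by $e_0,\ldots,e_{n-1}$. Taking $r$ rows in arithmetic sequence with difference $k$ means taking $e_s,e_{s+k},\ldots,e_{s+(r-1)k}$ for some $s$, with indices modulo $n$. *)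

theory Defs
  imports
    "HOL-Algebra.Algebra"
    "HOL-Computational_Algebra.Primes"
    "Jordan_Normal_Form.Missing_VectorSpace"
    "Jordan_Normal_Form.Matrix"
begin

definition vec_n :: "('a, 'm) ring_scheme \<Rightarrow> nat \<Rightarrow> ('a, nat \<Rightarrow> 'a) module"
  where "vec_n F n = ring.func_space F {..<n}"

definition linear_code :: "('a, 'm) ring_scheme \<Rightarrow> nat \<Rightarrow> nat \<Rightarrow> (nat \<Rightarrow> 'a) set \<Rightarrow> bool"
  where "linear_code F n r C \<longleftrightarrow>
    VectorSpace.subspace F C (vec_n F n) \<and>
    vectorspace.dim F ((vec_n F n)\<lparr>carrier := C\<rparr>) = r"

definition hamming_weight :: "('a, 'm) ring_scheme \<Rightarrow> nat \<Rightarrow> (nat \<Rightarrow> 'a) \<Rightarrow> nat"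
  where "hamming_weight F n c = card {i. i < n \<and> c i \<noteq> \<zero>\<^bsub>F\<^esub>}"

(* Unspecified for the zero code, which has no nonzero codeword. *)
definition min_distance :: "('a, 'm) ring_scheme \<Rightarrow> nat \<Rightarrow> (nat \<Rightarrow> 'a) set \<Rightarrow> nat"
  where "min_distance F n C = Min (hamming_weight F n ` (C - {\<zero>\<^bsub>vec_n F n\<^esub>}))"

(* For a nonzero code min_distance is at least 1, so the natural-number
   subtraction does not truncate. *)
definition error_capability :: "('a, 'm) ring_scheme \<Rightarrow> nat \<Rightarrow> (nat \<Rightarrow> 'a) set \<Rightarrow> nat"
  where "error_capability F n C = (min_distance F n C - 1) div 2"

definition code_with_distance ::
    "('a, 'm) ring_scheme \<Rightarrow> nat \<Rightarrow> nat \<Rightarrow> nat \<Rightarrow> (nat \<Rightarrow> 'a) set \<Rightarrow> bool"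
  where "code_with_distance F n r d C \<longleftrightarrow> linear_code F n r C \<and> min_distance F n C = d"

(* r <= n holds for the dimension of a subspace of F^n, so n - r does not truncate. *)
definition mds_code :: "('a, 'm) ring_scheme \<Rightarrow> nat \<Rightarrow> nat \<Rightarrow> (nat \<Rightarrow> 'a) set \<Rightarrow> bool"
  where "mds_code F n r C \<longleftrightarrow> code_with_distance F n r (n - r + 1) C"

definition code_rate :: "nat \<Rightarrow> nat \<Rightarrow> real"
  where "code_rate n r = real r / real n"

definition primitive_root_of_unity :: "('a, 'm) ring_scheme \<Rightarrow> nat \<Rightarrow> 'a \<Rightarrow> bool"
  where "primitive_root_of_unity F n \<omega> \<longleftrightarrow>
    \<omega> \<in> carrier F \<and> \<omega> [^]\<^bsub>F\<^esub> n = \<one>\<^bsub>F\<^esub> \<and> (\<forall>i\<in>{1..<n}. \<omega> [^]\<^bsub>F\<^esub> i \<noteq> \<one>\<^bsub>F\<^esub>)"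

definition is_fourier_matrix :: "('a, 'm) ring_scheme \<Rightarrow> nat \<Rightarrow> 'a mat \<Rightarrow> bool"
  where "is_fourier_matrix F n M \<longleftrightarrow>
    (\<exists>\<omega>. primitive_root_of_unity F n \<omega> \<and> M = mat n n (\<lambda>(i, j). \<omega> [^]\<^bsub>F\<^esub> (i * j)))"

definition mat_row :: "nat \<Rightarrow> 'a mat \<Rightarrow> nat \<Rightarrow> (nat \<Rightarrow> 'a)"
  where "mat_row n M i = (\<lambda>j\<in>{..<n}. M $$ (i, j))"

(* The rows e_s, e_(s+k), ..., e_(s+(r-1)k), indices modulo n. *)
definition arith_rows :: "nat \<Rightarrow> 'a mat \<Rightarrow> nat \<Rightarrow> nat \<Rightarrow> nat \<Rightarrow> (nat \<Rightarrow> 'a) set"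
  where "arith_rows n M s k r = {mat_row n M ((s + i * k) mod n) | i. i < r}"

definition generated_code :: "('a, 'm) ring_scheme \<Rightarrow> nat \<Rightarrow> (nat \<Rightarrow> 'a) set \<Rightarrow> (nat \<Rightarrow> 'a) set"
  where "generated_code F n S = LinearCombinations.module.span F (vec_n F n) S"

(* The additive order of 1; group.ord is 0 for elements of infinite order. *)
definition characteristic :: "('a, 'm) ring_scheme \<Rightarrow> nat"
  where "characteristic F = group.ord (add_monoid F) \<one>\<^bsub>F\<^esub>"

end

(* A nonzero codeword evaluates a nonzero polynomial of degree below r, up to nonzero factors, at the
   points w^(k j), which are pairwise distinct because k is coprime to n; so it has fewer than r zeros.
   Counting words shows that some nonzero codeword vanishes on the first r - 1 coordinates.
   The required finite field is generated over the prime field by a primitive n-th root of unity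
   in its algebraic closure. *)

theory Submission
  imports Defs "HOL-Number_Theory.Residues"
begin

subsection \<open>Generalized Reed--Solomon codes\<close>

text \<open>Column j of the row with index s + i k is w^(s j) * (w^(k j))^i, so the starting row
  only contributes a nonzero factor per column. The distance argument never uses more than distinct
  points and nonzero factors, and is therefore carried out for generalized Reed-Solomon codes. Since
  \<open>min_distance\<close> is a minimum over actual words, a lower bound on weights is not
  enough: the value must be attained. The pigeonhole principle provides the light word without
  building a polynomial with prescribed roots. For the field, the algebraic closure is infinite and
  lives on an unwieldy type. A finite subfield is cut out of it and then copied onto natural
  numbers, so both the characteristic and the primitivity of the root have to be carried along field
  homomorphisms.\<close>

definition (in ring) power_sum :: "nat \<Rightarrow> (nat \<Rightarrow> 'a) \<Rightarrow> 'a \<Rightarrow> 'a"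
  where "power_sum r a x = (\<Oplus>i\<in>{..<r}. a i \<otimes> x [^] i)"

context cring begin

lemma power_sum_closed [simp]:
  assumes "a \<in> {..<r} \<rightarrow> carrier R" "x \<in> carrier R"
  shows "power_sum r a x \<in> carrier R"
  unfolding power_sum_def using assms by (intro finsum_closed) auto

text \<open>Turns two coefficient vectors with equal values at a point into one vector that vanishes
  there.\<close>

lemma power_sum_minus:
  assumes "a \<in> {..<r} \<rightarrow> carrier R" "b \<in> {..<r} \<rightarrow> carrier R" "x \<in> carrier R"
  shows "power_sum r (\<lambda>i. a i \<ominus> b i) x = power_sum r a x \<ominus> power_sum r b x"
proof -
  have "power_sum r (\<lambda>i. a i \<ominus> b i) x \<oplus> power_sum r b x
      = (\<Oplus>i\<in>{..<r}. (a i \<ominus> b i) \<otimes> x [^] i \<oplus> b i \<otimes> x [^] i)"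
    unfolding power_sum_def using assms by (subst finsum_addf) auto
  also have "\<dots> = power_sum r a x"
    unfolding power_sum_def
  proof (rule finsum_cong')
    fix i assume "i \<in> {..<r}"
    then have "a i \<in> carrier R" "b i \<in> carrier R" "x [^] i \<in> carrier R" using assms by auto
    then show "(a i \<ominus> b i) \<otimes> x [^] i \<oplus> b i \<otimes> x [^] i = a i \<otimes> x [^] i" by algebra
  qed (use assms in auto)
  finally have *: "power_sum r (\<lambda>i. a i \<ominus> b i) x \<oplus> power_sum r b x = power_sum r a x" .
  have "(\<lambda>i. a i \<ominus> b i) \<in> {..<r} \<rightarrow> carrier R" using assms by auto
  then have "power_sum r (\<lambda>i. a i \<ominus> b i) x \<in> carrier R" "power_sum r b x \<in> carrier R"
    using assms by auto
  moreover have "y = (y \<oplus> z) \<ominus> z" if "y \<in> carrier R" "z \<in> carrier R" for y z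
    using that by algebra
  ultimately show ?thesis unfolding *[symmetric] by blast
qed

end

text \<open>The coefficients, cut off to zero from \<open>r\<close> on, form a polynomial. If it
  were nonzero, its degree would be at most \<open>r - 1\<close>, too small for all points of
  \<open>A\<close> to be roots.\<close>

lemma (in domain) power_sum_eq_zero_imp_coeff_zero:
  assumes fin: "finite (carrier R)"
    and a: "a \<in> {..<r} \<rightarrow> carrier R" and A: "A \<subseteq> carrier R" "r \<le> card A"
    and zero: "\<And>x. x \<in> A \<Longrightarrow> power_sum r a x = \<zero>" and i: "i < r"
  shows "a i = \<zero>"
proof -
  interpret R: UP_domain R "UP R" by unfold_locales
  define f where "f = (\<lambda>i. if i < r then a i else \<zero>)"
  have f: "f \<in> carrier (UP R)"
    unfolding UP_def up_def f_def using a by (auto intro!: exI[of _ r] bound.intro)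
  have coeff: "UnivPoly.coeff (UP R) f j = f j" for j
    using f unfolding UP_def by simp
  have "f = \<zero>\<^bsub>UP R\<^esub>"
  proof (rule ccontr)
    assume f0: "f \<noteq> \<zero>\<^bsub>UP R\<^esub>"
    have deg: "deg R f \<le> r - 1"
      using i by (intro R.deg_aboveI f, unfold coeff) (auto simp: f_def)
    have "UnivPoly.eval R R id x f = \<zero>" if "x \<in> A" for x
    proof -
      have x: "x \<in> carrier R" using that A by auto
      have "UnivPoly.eval R R id x f = (\<Oplus>j\<in>{..deg R f}. f j \<otimes> x [^] j)"
        using f by (simp add: UnivPoly.eval_def coeff)
      \<comment> \<open>Evaluation stops at the actual degree, which may lie below
        \<open>r - 1\<close>; the added terms have coefficient zero.\<close>
      also have "\<dots> = (\<Oplus>j\<in>{..<r}. f j \<otimes> x [^] j)"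
      proof (rule add.finprod_mono_neutral_cong_left)
        show "{..deg R f} \<subseteq> {..<r}" using deg i by auto
        show "f j \<otimes> x [^] j = \<zero>" if "j \<in> {..<r} - {..deg R f}" for j
          using R.deg_aboveD[of f j] that f x by (auto simp: coeff)
      qed (use x a in \<open>auto simp: f_def Pi_iff\<close>)
      also have "\<dots> = power_sum r a x"
        unfolding power_sum_def using x a by (intro finsum_cong') (auto simp: f_def)
      finally show ?thesis using zero that by simp
    qed
    then have "A \<subseteq> {x \<in> carrier R. UnivPoly.eval R R id x f = \<zero>}" using A by auto
    moreover have "finite {x \<in> carrier R. UnivPoly.eval R R id x f = \<zero>} \<and>
        card {x \<in> carrier R. UnivPoly.eval R R id x f = \<zero>} \<le> deg R f"
      using R.roots_bound[OF f f0 fin] .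
    ultimately have "card A \<le> deg R f" by (meson card_mono le_trans)
    with deg A i show False by linarith
  qed
  then have "f i = \<zero>" using coeff[of i] R.coeff_zero by simp
  then show ?thesis using i by (simp add: f_def)
qed


lemma (in comm_monoid) finprod_delta:
  assumes "finite A" "i \<in> A" "f i \<in> carrier G"
  shows "(\<Otimes>j\<in>A. if j = i then f j else \<one>) = f i"
proof -
  have "(\<Otimes>j\<in>A. if j = i then f j else \<one>) = (\<Otimes>j\<in>{i}. if j = i then f j else \<one>)"
    using assms by (intro finprod_mono_neutral_cong_right) auto
  then show ?thesis using assms by simp
qed

section \<open>Coordinatewise arithmetic in the space of words\<close>

context field begin

lemma vectorspace_vec_n: "vectorspace R (vec_n R n)"
proof -
  have "module R (vec_n R n)" unfolding vec_n_def by (rule func_space_is_module)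
  then show ?thesis by (simp add: vectorspace_def field_axioms)
qed

lemma vec_n_simps:
  "carrier (vec_n R n) = {..<n} \<rightarrow>\<^sub>E carrier R"
  "\<zero>\<^bsub>vec_n R n\<^esub> = (\<lambda>j\<in>{..<n}. \<zero>)"
  "v \<oplus>\<^bsub>vec_n R n\<^esub> w = (\<lambda>j\<in>{..<n}. v j \<oplus> w j)"
  "c \<odot>\<^bsub>vec_n R n\<^esub> v = (\<lambda>j\<in>{..<n}. c \<otimes> v j)"
  by (simp_all add: vec_n_def func_space_def)

lemma finsum_vec_n:
  assumes "finite I" "f \<in> I \<rightarrow> carrier (vec_n R n)"
  shows "finsum (vec_n R n) f I = (\<lambda>j\<in>{..<n}. \<Oplus>i\<in>I. f i j)"
proof -
  interpret V: vectorspace R "vec_n R n" by (rule vectorspace_vec_n)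
  show ?thesis
    using assms
  proof (induction I)
    case empty
    then show ?case by (simp add: vec_n_simps)
  next
    case (insert i I)
    then have "(\<Oplus>k\<in>insert i I. f k j) = f i j \<oplus> (\<Oplus>k\<in>I. f k j)" if "j < n" for j
      using that by (subst finsum_insert) (auto simp: vec_n_simps PiE_iff)
    with insert show ?case
      by (subst V.M.finsum_insert) (auto simp: vec_n_simps intro!: restrict_ext)
  qed
qed

end

text \<open>Generalized Reed--Solomon codes: the codeword of the coefficients $a_0,\dots,a_{r-1}$ evaluates
  $\sum_i a_i x^i$ at the points $\beta_j$ and scales the results by $u_j$.\<close>

locale reed_solomon = field R for R (structure) +
  fixes n r :: nat and \<beta> u :: "nat \<Rightarrow> 'a"
  assumes fin: "finite (carrier R)"
    and \<beta>: "\<beta> \<in> {..<n} \<rightarrow> carrier R" "inj_on \<beta> {..<n}"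
    and u: "u \<in> {..<n} \<rightarrow> carrier R - {\<zero>}"
    and r: "1 \<le> r" "r \<le> n"
begin

definition codeword :: "(nat \<Rightarrow> 'a) \<Rightarrow> nat \<Rightarrow> 'a"
  where "codeword a = (\<lambda>j\<in>{..<n}. u j \<otimes> power_sum r a (\<beta> j))"

text \<open>The word of the monomial x^i. For a Fourier matrix these words are the selected
  rows.\<close>

definition generator :: "nat \<Rightarrow> nat \<Rightarrow> 'a"
  where "generator i = (\<lambda>j\<in>{..<n}. u j \<otimes> \<beta> j [^] i)"

sublocale V: vectorspace R "vec_n R n"
  by (rule vectorspace_vec_n)

lemma generator_closed: "generator i \<in> carrier (vec_n R n)"
  unfolding generator_def vec_n_simps using \<beta> u
  by (intro restrict_PiE_iff[THEN iffD2] ballI m_closed nat_pow_closed) auto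

lemma codeword_zero_iff:
  assumes "a \<in> {..<r} \<rightarrow> carrier R" "j < n"
  shows "codeword a j = \<zero> \<longleftrightarrow> power_sum r a (\<beta> j) = \<zero>"
proof -
  have "u j \<in> carrier R" "u j \<noteq> \<zero>" "\<beta> j \<in> carrier R" using assms \<beta> u by auto
  then show ?thesis using assms by (simp add: codeword_def integral_iff)
qed

text \<open>Distinct points turn \<open>r\<close> vanishing coordinates into \<open>r\<close> roots.
  Distinctness and independence of the generators and the lower bound on weights all rest on
  this.\<close>

lemma coeff_zero_if_many_zeros:
  assumes a: "a \<in> {..<r} \<rightarrow> carrier R"
    and J: "J \<subseteq> {..<n}" "r \<le> card J" "\<And>j. j \<in> J \<Longrightarrow> codeword a j = \<zero>"
    and "i < r"
  shows "a i = \<zero>"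
proof (rule power_sum_eq_zero_imp_coeff_zero[OF fin a])
  show "\<beta> ` J \<subseteq> carrier R" using \<beta> J by auto
  show "r \<le> card (\<beta> ` J)" using \<beta>(2) J by (metis card_image inj_on_subset)
  show "power_sum r a x = \<zero>" if x: "x \<in> \<beta> ` J" for x
    using x J codeword_zero_iff[OF a] by auto
qed fact

lemma codeword_generator:
  assumes "i < r"
  shows "codeword (\<lambda>k. if k = i then \<one> else \<zero>) = generator i"
  unfolding codeword_def generator_def
proof (rule restrict_ext)
  fix j assume j: "j \<in> {..<n}"
  then have x: "\<beta> j \<in> carrier R" using \<beta> by auto
  have "power_sum r (\<lambda>k. if k = i then \<one> else \<zero>) (\<beta> j)
      = (\<Oplus>k\<in>{..<r}. if k = i then \<beta> j [^] k else \<zero>)"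
    unfolding power_sum_def using x by (intro finsum_cong') auto
  also have "\<dots> = \<beta> j [^] i" using x assms by (intro add.finprod_delta) auto
  finally show "u j \<otimes> power_sum r (\<lambda>k. if k = i then \<one> else \<zero>) (\<beta> j) = u j \<otimes> \<beta> j [^] i"
    by simp
qed

text \<open>Spans and bases are formed from the set of generators, so coefficients can be indexed by
  i < r only if no two generators coincide. If two did, the difference of their monomials would
  vanish at all n >= r points.\<close>

lemma inj_on_generator: "inj_on generator {..<r}"
proof (rule inj_onI, rule ccontr)
  fix i k assume ik: "i \<in> {..<r}" "k \<in> {..<r}" and eq: "generator i = generator k" and ne: "i \<noteq> k"
  define d where "d = (\<lambda>(i :: nat) l. if l = i then \<one> else \<zero>)"
  have d: "d i \<in> {..<r} \<rightarrow> carrier R" for i by (auto simp: d_def)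
  have m: "(\<lambda>l. d i l \<ominus> d k l) \<in> {..<r} \<rightarrow> carrier R" using d by auto
  \<comment> \<open>This coefficient is 1 by construction, which gives the contradiction.\<close>
  have "(\<lambda>l. d i l \<ominus> d k l) i = \<zero>"
  proof (rule coeff_zero_if_many_zeros[OF m])
    show "{..<n} \<subseteq> {..<n}" "r \<le> card {..<n}" "i < r" using r ik by auto
    fix j assume j: "j \<in> {..<n}"
    then have uj: "u j \<in> carrier R" "u j \<noteq> \<zero>" "\<beta> j \<in> carrier R" using \<beta> u by auto
    have "codeword (d i) j = codeword (d k) j"
      using eq ik codeword_generator unfolding d_def by auto
    then have "power_sum r (d i) (\<beta> j) = power_sum r (d k) (\<beta> j)"
      using j uj d by (simp add: codeword_def m_lcancel)
    then show "codeword (\<lambda>l. d i l \<ominus> d k l) j = \<zero>"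
      using j uj d by (subst codeword_zero_iff[OF m]) (auto simp: power_sum_minus)
  qed
  then show False using ne by (simp add: d_def a_minus_def)
qed

text \<open>Reindexing along the injective \<open>generator\<close> makes a combination of vectors a
  polynomial evaluation; the multiplier \<open>u j\<close> factors out of each column.\<close>

lemma lincomb_generators:
  assumes "c \<in> generator ` {..<r} \<rightarrow> carrier R"
  shows "V.lincomb c (generator ` {..<r}) = codeword (\<lambda>i. c (generator i))"
proof -
  have c: "c (generator i) \<in> carrier R" if "i < r" for i using that assms by auto
  have "V.lincomb c (generator ` {..<r})
      = (\<Oplus>\<^bsub>vec_n R n\<^esub>i\<in>{..<r}. c (generator i) \<odot>\<^bsub>vec_n R n\<^esub> generator i)"
    unfolding V.lincomb_def using c generator_closed
    by (subst V.M.add.finprod_reindex) (auto intro: inj_on_generator)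
  also have "\<dots> = (\<lambda>j\<in>{..<n}. \<Oplus>i\<in>{..<r}. (c (generator i) \<odot>\<^bsub>vec_n R n\<^esub> generator i) j)"
    using c generator_closed by (intro finsum_vec_n) auto
  also have "\<dots> = codeword (\<lambda>i. c (generator i))"
    unfolding codeword_def
  proof (rule restrict_ext)
    fix j assume j: "j \<in> {..<n}"
    then have uj: "u j \<in> carrier R" "\<beta> j \<in> carrier R" using \<beta> u by auto
    have "(\<Oplus>i\<in>{..<r}. (c (generator i) \<odot>\<^bsub>vec_n R n\<^esub> generator i) j)
        = (\<Oplus>i\<in>{..<r}. u j \<otimes> (c (generator i) \<otimes> \<beta> j [^] i))"
      using j uj c by (intro finsum_cong') (auto simp: vec_n_simps generator_def m_lcomm)
    also have "\<dots> = u j \<otimes> power_sum r (\<lambda>i. c (generator i)) (\<beta> j)"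
      unfolding power_sum_def using uj c by (intro finsum_rdistr[symmetric]) auto
    finally show "(\<Oplus>i\<in>{..<r}. (c (generator i) \<odot>\<^bsub>vec_n R n\<^esub> generator i) j)
        = u j \<otimes> power_sum r (\<lambda>i. c (generator i)) (\<beta> j)" .
  qed
  finally show ?thesis .
qed

lemma generators_closed: "generator ` {..<r} \<subseteq> carrier (vec_n R n)"
  using generator_closed by auto

lemma codeword_cong: "(\<And>i. i < r \<Longrightarrow> a i = b i) \<Longrightarrow> a \<in> {..<r} \<rightarrow> carrier R \<Longrightarrow> codeword a = codeword b"
  unfolding codeword_def power_sum_def using \<beta>
  by (intro restrict_ext arg_cong2[where f = "(\<otimes>)"] refl finsum_cong') (auto simp: Pi_iff)

text \<open>Extensional coefficient vectors present the code as the image of a finite set, so the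
  weights form a finite set.\<close>

lemma span_generators: "V.span (generator ` {..<r}) = codeword ` ({..<r} \<rightarrow>\<^sub>E carrier R)"
proof -
  have "V.span (generator ` {..<r})
      = {V.lincomb c (generator ` {..<r}) | c. c \<in> generator ` {..<r} \<rightarrow> carrier R}"
    using generators_closed by (intro V.finite_span) auto
  also have "\<dots> = codeword ` ({..<r} \<rightarrow>\<^sub>E carrier R)"
  proof (intro equalityI subsetI)
    fix v assume "v \<in> {V.lincomb c (generator ` {..<r}) | c. c \<in> generator ` {..<r} \<rightarrow> carrier R}"
    then obtain c where c: "c \<in> generator ` {..<r} \<rightarrow> carrier R"
      and v: "v = codeword (\<lambda>i. c (generator i))" using lincomb_generators by auto
    have "v = codeword (\<lambda>i\<in>{..<r}. c (generator i))"
      unfolding v using c by (intro codeword_cong) auto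
    moreover have "(\<lambda>i\<in>{..<r}. c (generator i)) \<in> {..<r} \<rightarrow>\<^sub>E carrier R" using c by auto
    ultimately show "v \<in> codeword ` ({..<r} \<rightarrow>\<^sub>E carrier R)" by blast
  next
    fix v assume "v \<in> codeword ` ({..<r} \<rightarrow>\<^sub>E carrier R)"
    then obtain a where a: "a \<in> {..<r} \<rightarrow>\<^sub>E carrier R" and v: "v = codeword a" by auto
    \<comment> \<open>Combinations take coefficients indexed by vectors; injectivity allows the
      index i to be read off from the generator.\<close>
    define c where "c = (\<lambda>g. a (the_inv_into {..<r} generator g))"
    have ca: "c (generator i) = a i" if "i < r" for i
      unfolding c_def using that inj_on_generator by (subst the_inv_into_f_f) auto
    then have c: "c \<in> generator ` {..<r} \<rightarrow> carrier R" using a by auto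
    have "v = V.lincomb c (generator ` {..<r})"
      unfolding v lincomb_generators[OF c] using a ca by (intro codeword_cong) auto
    with c show "v \<in> {V.lincomb c (generator ` {..<r}) | c. c \<in> generator ` {..<r} \<rightarrow> carrier R}"
      by blast
  qed
  finally show ?thesis .
qed

lemma codeword_eq_zero_iff:
  assumes "a \<in> {..<r} \<rightarrow> carrier R"
  shows "codeword a = \<zero>\<^bsub>vec_n R n\<^esub> \<longleftrightarrow> (\<forall>i<r. a i = \<zero>)"
proof
  assume "codeword a = \<zero>\<^bsub>vec_n R n\<^esub>"
  then have "codeword a j = \<zero>" if "j \<in> {..<n}" for j using that by (simp add: vec_n_simps)
  then show "\<forall>i<r. a i = \<zero>"
    using coeff_zero_if_many_zeros[OF assms, of "{..<n}"] r by auto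
next
  assume "\<forall>i<r. a i = \<zero>"
  then have "power_sum r a x = \<zero>" if "x \<in> carrier R" for x
    unfolding power_sum_def using that by (intro add.finprod_one_eqI) auto
  then show "codeword a = \<zero>\<^bsub>vec_n R n\<^esub>"
    unfolding codeword_def vec_n_simps using \<beta> u by (intro restrict_ext) (auto simp: Pi_iff)
qed

lemma lin_indpt_generators: "V.lin_indpt (generator ` {..<r})"
proof (rule V.finite_lin_indpt2)
  fix c assume c: "c \<in> generator ` {..<r} \<rightarrow> carrier R"
    and "V.lincomb c (generator ` {..<r}) = \<zero>\<^bsub>vec_n R n\<^esub>"
  then show "\<forall>v\<in>generator ` {..<r}. c v = \<zero>"
    using codeword_eq_zero_iff[of "\<lambda>i. c (generator i)"] by (auto simp: lincomb_generators Pi_iff)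
qed (use generators_closed in auto)

lemma linear_code_generators: "linear_code R n r (generated_code R n (generator ` {..<r}))"
proof -
  let ?G = "generator ` {..<r}"
  let ?W = "(vec_n R n)\<lparr>carrier := V.span ?G\<rparr>"
  have sub: "VectorSpace.subspace R (V.span ?G) (vec_n R n)"
    using generators_closed by (rule V.span_is_subspace)
  interpret W: vectorspace R ?W using V.subspace_is_vs[OF sub] .
  have G: "?G \<subseteq> V.span ?G" using generators_closed by (rule V.in_own_span)
  \<comment> \<open>The generators lie in their span, and independence in the whole space passes to
    this subspace viewed as a vector space of its own.\<close>
  have "W.basis ?G"
    unfolding W.basis_def
    using V.span_li_not_depend[OF G V.is_module[OF sub]] lin_indpt_generators G by simp
  then have "W.dim = card ?G" by (intro W.dim_basis) auto
  then show ?thesis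
    using sub by (simp add: linear_code_def generated_code_def card_image inj_on_generator)
qed

section \<open>Hamming weights and the minimum distance\<close>

lemma weight_codeword:
  "hamming_weight R n (codeword a) = n - card {j. j < n \<and> codeword a j = \<zero>}"
proof -
  have "{j. j < n \<and> codeword a j \<noteq> \<zero>} = {..<n} - {j. j < n \<and> codeword a j = \<zero>}" by auto
  then show ?thesis unfolding hamming_weight_def by (simp add: card_Diff_subset subset_iff)
qed

lemma weight_ge:
  assumes a: "a \<in> {..<r} \<rightarrow> carrier R" "codeword a \<noteq> \<zero>\<^bsub>vec_n R n\<^esub>"
  shows "n - r + 1 \<le> hamming_weight R n (codeword a)"
proof -
  have "card {j. j < n \<and> codeword a j = \<zero>} < r"
  proof (rule ccontr)
    assume "\<not> ?thesis"
    then have "a i = \<zero>" if "i < r" for i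
      using that by (intro coeff_zero_if_many_zeros[OF a(1), of "{j. j < n \<and> codeword a j = \<zero>}"]) auto
    then show False using a codeword_eq_zero_iff by auto
  qed
  then show ?thesis unfolding weight_codeword using r by linarith
qed

text \<open>There are more coefficient vectors than possible values on the first \<open>r - 1\<close> coordinates,
  so two codewords agree there, and their difference has weight at most \<open>n - r + 1\<close>.\<close>

lemma exists_codeword_weight_le:
  obtains a where "a \<in> {..<r} \<rightarrow>\<^sub>E carrier R" "codeword a \<noteq> \<zero>\<^bsub>vec_n R n\<^esub>"
    "hamming_weight R n (codeword a) \<le> n - r + 1"
proof -
  \<comment> \<open>The multipliers \<open>u j\<close> are left out: being nonzero, they do not
    affect where a difference vanishes.\<close>
  define h where "h a = (\<lambda>j\<in>{..<r - 1}. power_sum r a (\<beta> j))" for a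
  let ?A = "{..<r} \<rightarrow>\<^sub>E carrier R" and ?B = "{..<r - 1} \<rightarrow>\<^sub>E carrier R"
  \<comment> \<open>A field has at least two elements, so q^(r-1) < q^r holds strictly for its
    cardinality q.\<close>
  have "{\<zero>, \<one>} \<subseteq> carrier R" by auto
  then have "card {\<zero>, \<one>} \<le> card (carrier R)" using fin card_mono by blast
  then have "card ?B < card ?A" using r by (simp add: card_PiE)
  moreover have "h ` ?A \<subseteq> ?B"
  proof (intro image_subsetI)
    fix a assume "a \<in> ?A"
    then have a: "a \<in> {..<r} \<rightarrow> carrier R" by auto
    have "power_sum r a (\<beta> j) \<in> carrier R" if "j < r - 1" for j
      using \<beta> r that by (intro power_sum_closed a) auto
    then show "h a \<in> ?B" by (simp add: h_def PiE_iff)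
  qed
  ultimately have "\<not> inj_on h ?A"
    by (metis card_inj_on_le fin finite_PiE finite_lessThan leD)
  then obtain a b where a: "a \<in> ?A" and b: "b \<in> ?A" and eq: "h a = h b" and ne: "a \<noteq> b"
    unfolding inj_on_def by blast
  define d where "d = (\<lambda>i\<in>{..<r}. a i \<ominus> b i)"
  have ab: "a \<in> {..<r} \<rightarrow> carrier R" "b \<in> {..<r} \<rightarrow> carrier R"
    "(\<lambda>i. a i \<ominus> b i) \<in> {..<r} \<rightarrow> carrier R" using a b by auto
  have d: "d \<in> ?A" 
    unfolding d_def using ab(3) by (intro restrict_PiE_iff[THEN iffD2] ballI) (rule Pi_mem)
  have *: "codeword d = codeword (\<lambda>i. a i \<ominus> b i)"
  proof (rule codeword_cong)
    show "d \<in> {..<r} \<rightarrow> carrier R" using d by (simp add: PiE_def)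
  qed (simp add: d_def)
  \<comment> \<open>Extensionality of \<open>a\<close> and \<open>b\<close> places their
    disagreement at an index below \<open>r\<close>, where it is a coefficient of the
    polynomial.\<close>
  obtain i where i: "i < r" "a i \<noteq> b i" using ne a b by (meson PiE_ext lessThan_iff)
  have "codeword d \<noteq> \<zero>\<^bsub>vec_n R n\<^esub>"
  proof
    assume "codeword d = \<zero>\<^bsub>vec_n R n\<^esub>"
    then have "a i \<ominus> b i = \<zero>" using codeword_eq_zero_iff[OF ab(3)] i unfolding * by simp
    moreover have "a i \<in> carrier R" "b i \<in> carrier R" using ab i by auto
    ultimately show False using i(2) by simp
  qed
  moreover have "codeword d j = \<zero>" if "j < r - 1" for j
  proof -
    have "power_sum r a (\<beta> j) = power_sum r b (\<beta> j)"
      using fun_cong[OF eq, of j] that unfolding h_def by simp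
    moreover have "\<beta> j \<in> carrier R" using \<beta> that r by auto
    ultimately show ?thesis
      unfolding * using that r
      by (subst codeword_zero_iff[OF ab(3)]) (simp_all add: power_sum_minus[OF ab(1,2)] ab)
  qed
  then have "{..<r - 1} \<subseteq> {j. j < n \<and> codeword d j = \<zero>}" using r by auto
  then have "r - 1 \<le> card {j. j < n \<and> codeword d j = \<zero>}"
    using card_mono[of "{j. j < n \<and> codeword d j = \<zero>}" "{..<r - 1}"] by simp
  then have "hamming_weight R n (codeword d) \<le> n - r + 1" unfolding weight_codeword by linarith
  ultimately show thesis using that d by blast
qed

theorem mds_code_generators: "mds_code R n r (generated_code R n (generator ` {..<r}))"
proof -
  let ?C = "generated_code R n (generator ` {..<r})"
  have C: "?C = codeword ` ({..<r} \<rightarrow>\<^sub>E carrier R)"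
    by (simp add: generated_code_def span_generators)
  obtain a where a: "a \<in> {..<r} \<rightarrow>\<^sub>E carrier R" "codeword a \<noteq> \<zero>\<^bsub>vec_n R n\<^esub>"
    "hamming_weight R n (codeword a) \<le> n - r + 1" by (rule exists_codeword_weight_le)
  have "min_distance R n ?C = n - r + 1"
    unfolding min_distance_def
  proof (rule Min_eqI)
    show "finite (hamming_weight R n ` (?C - {\<zero>\<^bsub>vec_n R n\<^esub>}))"
      unfolding C using fin by (intro finite_imageI finite_Diff finite_PiE) auto
    show "n - r + 1 \<le> y" if "y \<in> hamming_weight R n ` (?C - {\<zero>\<^bsub>vec_n R n\<^esub>})" for y
      using that weight_ge unfolding C by (auto simp: PiE_iff)
    \<comment> \<open>The word found by counting meets the lower bound valid for all nonzero words,
      so the minimum is attained.\<close>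
    have "hamming_weight R n (codeword a) = n - r + 1"
      using a weight_ge[of a] by (intro antisym) auto
    then show "n - r + 1 \<in> hamming_weight R n ` (?C - {\<zero>\<^bsub>vec_n R n\<^esub>})"
      unfolding C using a by (metis DiffI imageI singletonD)
  qed
  then show ?thesis
    using linear_code_generators by (simp add: mds_code_def code_with_distance_def)
qed

end

subsection \<open>Codes from Fourier matrices\<close>

text \<open>Reducing the exponent modulo \<open>n\<close> does not change the power, and primitivity
  rules out every nonzero remainder.\<close>

lemma (in field) primitive_root_pow_eq_one_iff:
  assumes "primitive_root_of_unity R n w" "0 < n"
  shows "w [^] k = \<one> \<longleftrightarrow> n dvd (k :: nat)"
proof -
  have w: "w \<in> carrier R" "w [^] n = \<one>" and ne: "\<And>i. 1 \<le> i \<Longrightarrow> i < n \<Longrightarrow> w [^] i \<noteq> \<one>"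
    using assms(1) by (auto simp: primitive_root_of_unity_def)
  have "w [^] k = w [^] (n * (k div n)) \<otimes> w [^] (k mod n)"
    using nat_pow_mult[OF w(1), of "n * (k div n)" "k mod n"] by simp
  also have "w [^] (n * (k div n)) = \<one>"
    using nat_pow_pow[OF w(1), of n "k div n"] w by simp
  finally have "w [^] k = w [^] (k mod n)" using w by simp
  moreover have "w [^] (k mod n) = \<one> \<longleftrightarrow> k mod n = 0"
    using ne[of "k mod n"] assms(2) w by (cases "k mod n = 0") auto
  ultimately show ?thesis by (simp add: dvd_eq_mod_eq_0)
qed

lemma (in field) mds_code_arith_rows:
  assumes fin: "finite (carrier R)" and M: "is_fourier_matrix R n M"
    and r: "1 \<le> r" "r \<le> n" and gcd: "gcd n k = 1"
  shows "mds_code R n r (generated_code R n (arith_rows n M s k r))"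
proof -
  from M obtain w where w: "primitive_root_of_unity R n w"
    and M: "M = mat n n (\<lambda>(i, j). w [^] (i * j))" by (auto simp: is_fourier_matrix_def)
  have n: "0 < n" using r by simp
  have wc: "w \<in> carrier R" and wn: "w [^] n = \<one>" using w by (auto simp: primitive_root_of_unity_def)
  have "w \<noteq> \<zero>" using wn n nat_pow_zero[of n] by auto
  then have w_pow: "w [^] (i :: nat) \<in> carrier R - {\<zero>}" for i
    using wc by (induction i) (auto simp: integral_iff)
  \<comment> \<open>Absorbs the reduction modulo \<open>n\<close> of the row indices in
    \<open>arith_rows\<close>.\<close>
  have pow_mod: "w [^] (i mod n * j) = w [^] (i * j)" for i j :: nat
  proof -
    have "w [^] (i * j) = w [^] (n * (i div n * j)) \<otimes> w [^] (i mod n * j)"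
      using nat_pow_mult[OF wc, of "n * (i div n * j)" "i mod n * j"]
      by (metis add_mult_distrib mult.assoc mult_div_mod_eq)
    moreover have "w [^] (n * (i div n * j)) = \<one>"
      using primitive_root_pow_eq_one_iff[OF w n] by simp
    ultimately show ?thesis using wc by simp
  qed
  \<comment> \<open>The order \<open>i \<le> j\<close> keeps the subtraction exact: cancelling w^(k
    i) leaves w^(k (j - i)) = 1, so n divides k (j - i), and by coprimality j - i, which is below
    n.\<close>
  have inj_aux: "i = j" if "i \<le> j" "j < n" "w [^] (k * i) = w [^] (k * j)" for i j :: nat
  proof -
    have "k * j = k * i + k * (j - i)" using that(1) by (simp add: diff_mult_distrib2)
    then have "w [^] (k * i) \<otimes> w [^] (k * (j - i)) = w [^] (k * i) \<otimes> \<one>"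
      using nat_pow_mult[OF wc, of "k * i" "k * (j - i)"] that(3) wc by simp
    then have "w [^] (k * (j - i)) = \<one>"
      using w_pow[of "k * i"] wc m_lcancel[of "w [^] (k * i)" "w [^] (k * (j - i))" \<one>]
      by (metis DiffD1 DiffD2 insertI1 nat_pow_closed one_closed)
    then have "n dvd k * (j - i)" using primitive_root_pow_eq_one_iff[OF w n] by simp
    moreover have "coprime n k" using gcd by (simp only: coprime_iff_gcd_eq_1)
    ultimately have "n dvd j - i" by (simp only: coprime_dvd_mult_right_iff)
    moreover have "j - i < n" using that by simp
    ultimately have "j - i = 0" using dvd_imp_le by fastforce
    then show "i = j" using that(1) by simp
  qed
  interpret reed_solomon R n r "\<lambda>j. w [^] (k * j)" "\<lambda>j. w [^] (s * j)"
  proof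
    show "inj_on (\<lambda>j. w [^] (k * j)) {..<n}"
    proof (rule inj_onI)
      fix i j assume "i \<in> {..<n}" "j \<in> {..<n}" "w [^] (k * i) = w [^] (k * j)"
      then show "i = j" using inj_aux[of i j] inj_aux[of j i] by (cases "i \<le> j") auto
    qed
  qed (use fin r w_pow in auto)
  have "mat_row n M ((s + i * k) mod n) = generator i" for i
    unfolding mat_row_def generator_def
  proof (rule restrict_ext)
    fix j assume "j \<in> {..<n}"
    then have "M $$ ((s + i * k) mod n, j) = w [^] ((s + i * k) * j)" by (simp add: M pow_mod)
    also have "\<dots> = w [^] (s * j) \<otimes> (w [^] (k * j)) [^] i"
      using wc by (simp add: nat_pow_pow nat_pow_mult algebra_simps)
    finally show "M $$ ((s + i * k) mod n, j) = w [^] (s * j) \<otimes> (w [^] (k * j)) [^] i" .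
  qed
  then have "arith_rows n M s k r = generator ` {..<r}" by (auto simp: arith_rows_def)
  then show ?thesis using mds_code_generators by simp
qed

subsection \<open>Finite fields with primitive roots of unity\<close>

text \<open>Field homomorphisms are injective, so no power becomes 1 that was not 1 before. The
  equivalence serves to descend from the closure to a subfield and to move on to an isomorphic
  copy.\<close>

lemma primitive_root_of_unity_hom:
  assumes "field R" "field S" "h \<in> Ring.ring_hom R S" "x \<in> carrier R"
  shows "primitive_root_of_unity S n (h x) \<longleftrightarrow> primitive_root_of_unity R n x"
proof -
  interpret R: field R by fact
  interpret S: field S by fact
  interpret h: ring_hom_ring R S h
    using assms by (intro ring_hom_ringI2 R.ring_axioms S.ring_axioms)
  have "h x [^]\<^bsub>S\<^esub> k = \<one>\<^bsub>S\<^esub> \<longleftrightarrow> x [^]\<^bsub>R\<^esub> k = \<one>\<^bsub>R\<^esub>" for k :: nat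
    using inj_on_eq_iff[OF non_trivial_field_hom_is_inj[OF assms(3,1,2)], of "x [^]\<^bsub>R\<^esub> k" "\<one>\<^bsub>R\<^esub>"] assms(4)
    by (simp add: h.hom_nat_pow)
  then show ?thesis using assms(4) by (simp add: primitive_root_of_unity_def)
qed

text \<open>The divisibility form also covers characteristic 0, as 0 divides only 0, and it
  transfers along homomorphisms.\<close>

lemma (in ring) characteristic_eq_iff:
  "characteristic R = d \<longleftrightarrow> (\<forall>k. [k] \<cdot> \<one> = \<zero> \<longleftrightarrow> d dvd k)"
proof -
  show ?thesis
    using add.ord_unique[of \<one> d] by (simp add: characteristic_def add_pow_def)
qed

lemma characteristic_hom:
  assumes "field R" "field S" "h \<in> Ring.ring_hom R S"
  shows "characteristic S = characteristic R"
proof -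
  interpret R: field R by fact
  interpret S: field S by fact
  interpret h: ring_hom_ring R S h
    using assms by (intro ring_hom_ringI2 R.ring_axioms S.ring_axioms)
  have "h ([k] \<cdot>\<^bsub>R\<^esub> \<one>\<^bsub>R\<^esub>) = [k] \<cdot>\<^bsub>S\<^esub> \<one>\<^bsub>S\<^esub>" for k :: nat
    by (induction k) (simp_all add: R.add.nat_pow_Suc S.add.nat_pow_Suc)
  then have "[k] \<cdot>\<^bsub>S\<^esub> \<one>\<^bsub>S\<^esub> = \<zero>\<^bsub>S\<^esub> \<longleftrightarrow> [k] \<cdot>\<^bsub>R\<^esub> \<one>\<^bsub>R\<^esub> = \<zero>\<^bsub>R\<^esub>" for k :: nat
    using inj_on_eq_iff[OF non_trivial_field_hom_is_inj[OF assms(3,1,2)], of "[k] \<cdot>\<^bsub>R\<^esub> \<one>\<^bsub>R\<^esub>" "\<zero>\<^bsub>R\<^esub>"]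
    by (metis R.add.nat_pow_closed R.one_closed R.zero_closed h.hom_zero)
  then show ?thesis
    using R.characteristic_eq_iff by (subst S.characteristic_eq_iff) auto
qed

lemma (in residues) characteristic_residue_ring: "characteristic R = nat m"
proof -
  have "[k] \<cdot> \<one> = int k mod m" for k :: nat
  proof (induction k)
    case 0
    then show ?case by (simp add: res_zero_eq)
  next
    case (Suc k)
    then show ?case by (simp add: add.nat_pow_Suc res_add_eq res_one_eq mod_simps add.commute)
  qed
  then show ?thesis
    using m_gt_one unfolding characteristic_eq_iff
    by (simp add: res_zero_eq mod_eq_0_iff_dvd int_dvd_int_iff[symmetric])
qed

text \<open>The list of \<open>k\<close> ones is the polynomial 1 + x + ... + x^(k-1), so this is
  the telescoping geometric sum.\<close>

lemma (in cring) eval_replicate_one: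
  assumes "x \<in> carrier R"
  shows "(x \<ominus> \<one>) \<otimes> eval (replicate k \<one>) x = x [^] k \<ominus> \<one>"
proof (induction k)
  case 0
  then show ?case using assms by (simp add: a_minus_def r_neg)
next
  case (Suc k)
  let ?e = "eval (replicate k \<one>) x"
  have c: "?e \<in> carrier R" "x [^] k \<in> carrier R" using assms by (auto intro!: eval_in_carrier)
  have "(x \<ominus> \<one>) \<otimes> (x [^] k \<oplus> ?e) = (x \<ominus> \<one>) \<otimes> x [^] k \<oplus> (x \<ominus> \<one>) \<otimes> ?e"
    using assms c by (simp add: r_distr)
  also have "\<dots> = x [^] k \<otimes> x \<ominus> \<one>"
    unfolding Suc using assms c(2) by algebra
  finally show ?case using assms c by simp
qed

lemma (in cring) eval_replicate_one_one: "eval (replicate k \<one>) \<one> = [k] \<cdot> \<one>"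
  by (induction k) (simp_all add: a_comm)

section \<open>Roots of unity in algebraically closed fields\<close>

context algebraically_closed begin

lemma exists_eval_zero:
  assumes "p \<in> carrier (poly_ring L)" "0 < degree p"
  shows "\<exists>x\<in>carrier L. eval p x = \<zero>"
proof -
  have "roots p \<noteq> {#}"
    using roots_over_carrier[OF assms(1)] assms(2) by (auto simp: splitted_def)
  then show ?thesis
    using roots_mem_iff_is_root[OF assms(1)] by (auto simp: is_root_def)
qed

lemma exists_nat_root:
  assumes "a \<in> carrier L" "0 < k"
  shows "\<exists>x\<in>carrier L. x [^] (k :: nat) = a"
proof -
  \<comment> \<open>The coefficient list of X^k - a, leading coefficient first.\<close>
  define p where "p = \<one> # replicate (k - 1) \<zero> @ [\<ominus> a]"
  have "p \<in> carrier (poly_ring L)" "0 < degree p"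
    using assms by (auto simp: p_def univ_poly_carrier[symmetric] polynomial_def)
  then obtain x where x: "x \<in> carrier L" "eval p x = \<zero>" using exists_eval_zero by blast
  have "eval p x = x [^] k \<ominus> a"
    using assms x(1) by (simp add: p_def eval_replicate a_minus_def)
  with x assms show ?thesis by auto
qed

text \<open>A root of 1 + x + ... + x^(k-1) is a k-th root of unity, and it differs from 1 because
  the value at 1 is k times 1. Here the characteristic enters.\<close>

lemma exists_nontrivial_root_of_unity:
  assumes "1 < k" "[k] \<cdot> \<one> \<noteq> \<zero>"
  shows "\<exists>x\<in>carrier L. x [^] (k :: nat) = \<one> \<and> x \<noteq> \<one>"
proof -
  define p where "p = replicate k \<one>"
  have "p \<in> carrier (poly_ring L)" "0 < degree p"
    using assms by (auto simp: p_def univ_poly_carrier[symmetric] polynomial_def)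
  then obtain x where x: "x \<in> carrier L" "eval p x = \<zero>" using exists_eval_zero by blast
  then have "x [^] k \<ominus> \<one> = \<zero>"
    using eval_replicate_one[of x k] by (simp add: p_def)
  moreover have "x \<noteq> \<one>" using x assms eval_replicate_one_one by (auto simp: p_def)
  ultimately show ?thesis using x by auto
qed

text \<open>One prime factor of the order is added at a time: if \<open>l\<close> divides \<open>m\<close>, an \<open>l\<close>-th root of an
  element of order \<open>m\<close> has order \<open>l * m\<close>; otherwise multiply by an element of order \<open>l\<close>.\<close>

lemma exists_pow_eq_one_iff_dvd:
  assumes "0 < n" "\<And>l. Factorial_Ring.prime l \<Longrightarrow> l dvd n \<Longrightarrow> [l] \<cdot> \<one> \<noteq> \<zero>"
  shows "\<exists>x\<in>carrier L. \<forall>k :: nat. x [^] k = \<one> \<longleftrightarrow> n dvd k"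
  using assms
proof (induction n rule: prime_divisors_induct)
  case zero
  then show ?case by simp
next
  case (unit n)
  then show ?case by (intro bexI[of _ \<one>]) auto
next
  case (factor l m)
  then have l: "1 < l" and m: "0 < m" using prime_gt_1_nat by auto
  from factor.IH factor.prems obtain z where z: "z \<in> carrier L"
    and ord_z: "\<And>k :: nat. z [^] k = \<one> \<longleftrightarrow> m dvd k" using m by (meson dvd_mult)
  show ?case
  proof (cases "l dvd m")
    case True
    have "0 < l" using l by simp
    from exists_nat_root[OF z this] obtain x where x: "x \<in> carrier L" "x [^] l = z" by blast
    have pow: "x [^] (l * k) = z [^] k" for k
      unfolding x(2)[symmetric] using x(1) by (simp add: nat_pow_pow)
    have "x [^] k = \<one> \<longleftrightarrow> l * m dvd k" for k
    proof
      assume "x [^] k = \<one>"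
      moreover have "x [^] (l * k) = (x [^] k) [^] l"
        using x(1) by (simp add: nat_pow_pow mult.commute)
      ultimately have "z [^] k = \<one>" unfolding pow by simp
      \<comment> \<open>From m | k and l | m. Only with k a multiple of l can the power of x be
        rewritten as a power of z.\<close>
      then have "l dvd k" using ord_z True dvd_trans by blast
      then obtain j where j: "k = l * j" ..
      with \<open>x [^] k = \<one>\<close> have "z [^] j = \<one>" by (simp only: pow)
      then show "l * m dvd k" using j ord_z by simp
    next
      assume "l * m dvd k"
      then obtain j where "k = l * (m * j)" by (auto simp: dvd_def mult.assoc)
      then show "x [^] k = \<one>" using ord_z[of "m * j"] by (simp only: pow) simp
    qed
    with x show ?thesis by blast
  next
    case False
    have "[l] \<cdot> \<one> \<noteq> \<zero>" using factor by simp
    from exists_nontrivial_root_of_unity[OF l this] obtain y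
      where y: "y \<in> carrier L" "y [^] l = \<one>" "y \<noteq> \<one>" by blast
    interpret M: group "Multiplicative_Group.mult_of L" by (rule field_mult_group)
    have "y \<noteq> \<zero>" using y l by (metis gr_implies_not_zero nat_pow_zero zero_not_one)
    then have yM: "y \<in> carrier (Multiplicative_Group.mult_of L)" using y by simp
    have "M.ord y dvd l" using M.pow_eq_id[OF yM, of l] y by (simp add: Multiplicative_Group.nat_pow_mult_of)
    moreover have "M.ord y \<noteq> 1" using M.ord_eq_1[OF yM] y by simp
    ultimately have "M.ord y = l" using factor(1) by (meson prime_nat_iff)
    then have ord_y: "y [^] k = \<one> \<longleftrightarrow> l dvd k" for k :: nat
      using M.pow_eq_id[OF yM, of k] by (simp add: Multiplicative_Group.nat_pow_mult_of)
    have cop: "coprime l m" using factor(1) False prime_imp_coprime by blast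
    have "(y \<otimes> z) [^] k = \<one> \<longleftrightarrow> l * m dvd k" for k :: nat
    proof
      have pow: "(y \<otimes> z) [^] j = y [^] j \<otimes> z [^] j" for j :: nat
        using y z by (simp add: nat_pow_distrib)
      {
        \<comment> \<open>Raising to the power l removes y and raising to the power m removes z,
          which separates the two orders.\<close>
        assume one: "(y \<otimes> z) [^] k = \<one>"
        have "(y \<otimes> z) [^] (k * j) = \<one>" for j
          using nat_pow_pow[of "y \<otimes> z" k j] one y z by simp
        then have *: "y [^] (k * j) \<otimes> z [^] (k * j) = \<one>" for j using pow by metis
        have "y [^] (k * l) = \<one>" "z [^] (k * m) = \<one>" by (simp_all add: ord_y ord_z)
        then have "z [^] (k * l) = \<one>" "y [^] (k * m) = \<one>" using *[of l] *[of m] y z by auto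
        then have "m dvd k * l" "l dvd k * m" by (simp_all add: ord_y ord_z)
        then have "m dvd k" "l dvd k" using cop
          by (simp_all add: coprime_dvd_mult_left_iff coprime_commute)
        then show "l * m dvd k" using cop by (metis semiring_gcd_class.divides_mult)
      }
      assume "l * m dvd k"
      then have "l dvd k" "m dvd k" by (auto dest: dvd_mult_left dvd_mult_right)
      then show "(y \<otimes> z) [^] k = \<one>" unfolding pow by (simp add: ord_y[THEN iffD2] ord_z[THEN iffD2])
    qed
    with y z show ?thesis by blast
  qed
qed

end

text \<open>Adjoining an algebraic element gives a finite-dimensional extension, and over a finite
  \<open>K\<close> a fixed base admits only finitely many coefficient lists.\<close>

lemma (in domain) finite_simple_extension:
  assumes "subfield K R" "finite K" "x \<in> carrier R" "(algebraic over K) x"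
  shows "finite (simple_extension K x)"
proof -
  from exists_base[OF assms(1) dimension_simple_extension[OF assms(1,3,4)]]
  obtain Us where Us: "set Us \<subseteq> carrier R" "Span K Us = simple_extension K x" by blast
  have "Span K Us = (\<lambda>Ks. combine Ks Us) ` {Ks. set Ks \<subseteq> K \<and> length Ks = length Us}"
    using Span_eq_combine_set_length_version[OF assms(1) Us(1)] by auto
  then show ?thesis
    unfolding Us(2)[symmetric] by (metis finite_imageI finite_lists_length_eq[OF assms(2)])
qed

theorem exists_finite_field_with_primitive_root:
  assumes p: "Factorial_Ring.prime p" and "\<not> p dvd n"
  shows "\<exists>(F :: nat ring) \<omega>. field F \<and> finite (carrier F) \<and> characteristic F = p \<and>
    primitive_root_of_unity F n \<omega>"
proof -
  interpret P: residues_prime p "residue_ring (int p)"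
    by unfold_locales (use p in auto)
  have F: "field (residue_ring (int p))" by (rule P.is_field)
  obtain L :: "((int list \<times> nat) multiset \<Rightarrow> int) ring"
    where L: "algebraic_closure L (ring.indexed_const (residue_ring (int p)) ` carrier (residue_ring (int p)))"
      and hom: "ring.indexed_const (residue_ring (int p)) \<in> Ring.ring_hom (residue_ring (int p)) L"
    using field.exists_closure[OF F] by blast
  define K :: "((int list \<times> nat) multiset \<Rightarrow> int) set" where "K = ring.indexed_const (residue_ring (int p)) ` carrier (residue_ring (int p))"
  interpret L: algebraic_closure L K using L by (simp add: K_def)
  have charL: "characteristic L = p"
    using characteristic_hom[OF F L.field_axioms hom] P.characteristic_residue_ring by simp
  \<comment> \<open>If l times 1 vanished, p would divide the prime l, hence equal it and divide
    n.\<close>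
  then have "[l] \<cdot>\<^bsub>L\<^esub> \<one>\<^bsub>L\<^esub> \<noteq> \<zero>\<^bsub>L\<^esub>" if "Factorial_Ring.prime l" "l dvd n" for l
    using that L.characteristic_eq_iff[of p] assms primes_dvd_imp_eq by blast
  moreover have "0 < n" using assms by (auto intro: gr0I)
  ultimately obtain w where w: "w \<in> carrier L"
    and ord: "\<And>k :: nat. w [^]\<^bsub>L\<^esub> k = \<one>\<^bsub>L\<^esub> \<longleftrightarrow> n dvd k"
    using L.exists_pow_eq_one_iff_dvd by meson
  have prim: "primitive_root_of_unity L n w"
    using w by (auto simp: primitive_root_of_unity_def ord dest: dvd_imp_le)
  have alg: "(L.algebraic over K) w" using L.algebraic_extension w by simp
  define E where "E = L.simple_extension K w"
  have E: "subfield E L"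
    unfolding E_def using L.simple_extension_is_subfield[OF L.subfield_axioms w] alg by simp
  have wE: "w \<in> E"
    unfolding E_def using L.simple_extension_mem subfieldE(1)[OF L.subfield_axioms] w by simp
  have "finite E"
    unfolding E_def using P.finite
    by (intro L.finite_simple_extension L.subfield_axioms w alg) (simp add: K_def)
  \<comment> \<open>Finiteness of \<open>E\<close> allows its field structure to be transported to a
    set of natural numbers.\<close>
  then obtain f :: "_ \<Rightarrow> nat" where f: "inj_on f E"
    using finite_imp_inj_to_nat_seg by metis
  let ?E = "L\<lparr>carrier := E\<rparr>" and ?F = "image_ring f (L\<lparr>carrier := E\<rparr>)"
  have fieldE: "field ?E" using L.subfield_iff(2)[OF E] .
  have fieldF: "field ?F" using field.inj_imp_image_ring_is_field[OF fieldE] f by simp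
  have id: "id \<in> Ring.ring_hom ?E L" using subfieldE(3)[OF E] by (auto intro!: ring_hom_memI)
  have f_hom: "f \<in> Ring.ring_hom ?E ?F"
    using inj_imp_image_ring_iso[of f ?E] f by (simp add: ring_iso_def)
  have "characteristic ?F = p"
    using characteristic_hom[OF fieldE fieldF f_hom] characteristic_hom[OF fieldE L.field_axioms id] charL
    by simp
  moreover have "primitive_root_of_unity ?F n (f w)"
    using primitive_root_of_unity_hom[OF fieldE fieldF f_hom, of w n]
      primitive_root_of_unity_hom[OF fieldE L.field_axioms id, of w n] prim wE by simp
  moreover have "finite (carrier ?F)" using \<open>finite E\<close> by (simp add: image_ring_carrier)
  ultimately show ?thesis using fieldF by blast
qed

section \<open>Length, rate and error correction of the codes\<close>

theorem mainTheorem3: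
  fixes F :: "('a, 'm) ring_scheme" and R :: real and t :: nat
  assumes "field F" and "0 < R" and "R < 1" and "1 \<le> t"
  shows
    "(\<forall>n r C. mds_code F n r C \<and> real r \<ge> real n * R \<and> error_capability F n C \<ge> t \<longrightarrow>
        n - r + 1 \<ge> 2 * t + 1 \<and>
        real n * (1 - R) \<ge> 2 * real t \<and>
        real n \<ge> 2 * real t / (1 - R))
   \<and> (\<forall>n p. Factorial_Ring.prime p \<and> \<not> p dvd n \<longrightarrow>
        (\<exists>(F' :: nat ring) M. field F' \<and> finite (carrier F') \<and> characteristic F' = p \<and>
           is_fourier_matrix F' n M))
   \<and> (\<forall>n. real n \<ge> 2 * real t / (1 - R) \<longrightarrow>
        (\<exists>r. real r \<ge> real n * R \<and> n - r + 1 \<ge> 2 * t + 1) \<and>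
        (\<forall>M r s k. finite (carrier F) \<and> is_fourier_matrix F n M \<and>
             real r \<ge> real n * R \<and> n - r + 1 \<ge> 2 * t + 1 \<and> gcd n k = 1 \<longrightarrow>
           (let C = generated_code F n (arith_rows n M s k r) in
              mds_code F n r C \<and>
              code_with_distance F n r (n - r + 1) C \<and>
              code_rate n r \<ge> R \<and>
              (real r = real n * R \<longrightarrow> code_rate n r = R) \<and>
              error_capability F n C \<ge> t)))"
proof (intro conjI allI impI)
  fix n r C assume "mds_code F n r C \<and> real r \<ge> real n * R \<and> error_capability F n C \<ge> t"
  \<comment> \<open>The MDS distance minus 1 is exactly n - r.\<close>
  then have "(n - r) div 2 \<ge> t" and rate: "real r \<ge> real n * R"
    by (auto simp: mds_code_def code_with_distance_def error_capability_def)
  then have d: "n - r \<ge> 2 * t" by linarith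
  then show "n - r + 1 \<ge> 2 * t + 1" by simp
  \<comment> \<open>As t >= 1, the truncated difference n - r is positive, hence equal to the real
    one.\<close>
  have "real n - real r \<ge> 2 * real t" using d \<open>1 \<le> t\<close> by linarith
  with rate show *: "real n * (1 - R) \<ge> 2 * real t" by (simp add: algebra_simps)
  then show "real n \<ge> 2 * real t / (1 - R)" using \<open>R < 1\<close> by (simp add: field_simps)
next
  fix n p :: nat assume "Factorial_Ring.prime p \<and> \<not> p dvd n"
  then show "\<exists>(F' :: nat ring) M. field F' \<and> finite (carrier F') \<and> characteristic F' = p \<and>
      is_fourier_matrix F' n M"
    using exists_finite_field_with_primitive_root[of p n] unfolding is_fourier_matrix_def by blast
next
  fix n assume "real n \<ge> 2 * real t / (1 - R)"
  then have n: "real n * (1 - R) \<ge> 2 * real t" using \<open>R < 1\<close> by (simp add: field_simps)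
  have "real n * (1 - R) \<le> real n" using \<open>0 < R\<close> by (simp add: mult_left_le)
  with n have "2 * t \<le> n" by linarith
  \<comment> \<open>The witness r = n - 2 t is the largest dimension that the distance requirement
    permits.\<close>
  then have "real (n - 2 * t) \<ge> real n * R" "n - (n - 2 * t) + 1 \<ge> 2 * t + 1"
    using n by (simp_all add: of_nat_diff algebra_simps)
  then show "\<exists>r. real r \<ge> real n * R \<and> n - r + 1 \<ge> 2 * t + 1" by blast
  fix M r s k
  assume A: "finite (carrier F) \<and> is_fourier_matrix F n M \<and>
    real r \<ge> real n * R \<and> n - r + 1 \<ge> 2 * t + 1 \<and> gcd n k = 1"
  \<comment> \<open>This makes n positive, so that n R > 0 forces r >= 1: a zero code has no minimum
    distance.\<close>
  then have "r < n" using \<open>1 \<le> t\<close> by linarith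
  then have "0 < real n * R" using \<open>0 < R\<close> by simp
  then have "1 \<le> r" using A by linarith
  with A \<open>r < n\<close> have mds: "mds_code F n r (generated_code F n (arith_rows n M s k r))"
    by (intro field.mds_code_arith_rows[OF \<open>field F\<close>]) auto
  then have "code_with_distance F n r (n - r + 1) (generated_code F n (arith_rows n M s k r))"
    by (simp add: mds_code_def)
  moreover from this have "error_capability F n (generated_code F n (arith_rows n M s k r)) \<ge> t"
    using A by (auto simp: code_with_distance_def error_capability_def)
  moreover have "code_rate n r \<ge> R" "real r = real n * R \<longrightarrow> code_rate n r = R"
    using A \<open>r < n\<close> by (auto simp: code_rate_def field_simps)
  ultimately show "let C = generated_code F n (arith_rows n M s k r) in
      mds_code F n r C \<and> code_with_distance F n r (n - r + 1) C \<and> code_rate n r \<ge> R \<and>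
      (real r = real n * R \<longrightarrow> code_rate n r = R) \<and> error_capability F n C \<ge> t"
    using mds by (simp add: Let_def)
qed

end
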